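(* Let $f$ be a symmetric probability density function on $\mathbb{R}$ having the Poisson's summation property, and assume that the moments of $f$ are finite for all orders. Let $\psi(x)=\sum_{n=1}^{\infty}\hat f(\sqrt{2\pi}\,xn)$ for $x>0$. Then the Mellin transform $\eta(s)$ of $\psi$ satisfies, for $s>1$, $$\eta(s)\equiv\int_0^\infty x^{s-1}\psi(x)\,dx=\left(\frac{1}{\sqrt{2\pi}}\right)^{s}\zeta(s)\int_0^\infty x^{s-1}\hat f(x)\,dx=\left(\frac{1}{\sqrt{2\pi}}\right)^{s-1}\zeta(s)\int_0^\infty x^{s-1}f(x)\,dx,$$ and the function $\xi(s)\equiv s(s-1)\eta(s)$ is an entire function of $s\in\mathbb{C}$ and satisfies the functional equation $\xi(s)=\xi(1-s)$.
   Context: For a probability density function $f$ on $\mathbb{R}$, $\hat f(t)=\int_{\mathbb{R}}e^{itx}f(x)\,dx$ denotes its characteristic function. A symmetric probability density function $f$ on $\mathbb{R}$ (i.e. $f(-x)=f(x)$) is said to have the Poisson's summation property if (1) $\hat f$ is decreasing on $[0,\infty)$ and $\int_{\mathbb{R}}|\hat f(t)|\,dt<\infty$; and (2) $f$ is self-reciprocal, that is, $\hat f(t)=\sqrt{2\pi}\,f(t)$ for all $t\in\mathbb{R}$. $\zeta$ is the Riemann zeta function. Functions given by a formula for $s>1$ are identified with their analytic continuation; saying that such a function is entire means that it extends to an entire function, and the functional equation refers to that extension. *)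

theory Defs
  imports "HOL-Probability.Probability" "HOL-Complex_Analysis.Complex_Analysis"
begin

definition prob_density :: "(real \<Rightarrow> real) \<Rightarrow> bool" where
  "prob_density f \<longleftrightarrow>
     f \<in> borel_measurable borel \<and> (\<forall>x. 0 \<le> f x) \<and> prob_space (density lborel f)"

definition charfun :: "(real \<Rightarrow> real) \<Rightarrow> real \<Rightarrow> complex" where
  "charfun f = char (density lborel f)"

lemma charfun_eq_integral:
  assumes "prob_density f"
  shows "charfun f t = (CLBINT x. iexp (t * x) * of_real (f x))"
proof -
  have "charfun f t = (CLBINT x. f x *\<^sub>R iexp (t * x))"
    using assms unfolding charfun_def char_def prob_density_def
    by (subst integral_density) auto
  then show ?thesis
    by (simp add: scaleR_conv_of_real mult.commute)
qed

(* The characteristic function of a symmetric density is real-valued, so Re only changes the type. *)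
definition poisson_summation_property :: "(real \<Rightarrow> real) \<Rightarrow> bool" where
  "poisson_summation_property f \<longleftrightarrow>
     prob_density f \<and> (\<forall>x. f (- x) = f x) \<and>
     antimono_on {0..} (\<lambda>t. Re (charfun f t)) \<and>
     integrable lborel (charfun f) \<and>
     (\<forall>t. charfun f t = of_real (sqrt (2 * pi) * f t))"

definition psi :: "(real \<Rightarrow> real) \<Rightarrow> real \<Rightarrow> complex" where
  "psi f x = (\<Sum>n. charfun f (sqrt (2 * pi) * x * real (Suc n)))"

definition mellin_convergent :: "(real \<Rightarrow> complex) \<Rightarrow> complex \<Rightarrow> bool" where
  "mellin_convergent g s \<longleftrightarrow>
     set_integrable lborel {0<..} (\<lambda>x. of_real x powr (s - 1) * g x)"

definition mellin :: "(real \<Rightarrow> complex) \<Rightarrow> complex \<Rightarrow> complex" where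
  "mellin g s = (CLBINT x:{0<..}. of_real x powr (s - 1) * g x)"

(* The Dirichlet series represents the Riemann zeta function only for Re s > 1. *)
definition zeta :: "complex \<Rightarrow> complex" where
  "zeta s = (\<Sum>n. 1 / of_nat (Suc n) powr s)"

end

theory Submission
  imports Defs
begin

text \<open>
  Write $w = \sqrt{2\pi}$. The argument is Riemann's second proof of the functional equation of the
  zeta function, with the Gaussian replaced by an arbitrary self-reciprocal density.

  Since $\hat f = w f$ is nonnegative and decreasing on $[0,\infty)$, finiteness of the moments
  forces $f$ to decay faster than every power (\<open>antimono_moment_bound\<close>). Hence for $\operatorname{Re} s > 1$
  all series and integrals converge absolutely, and integrating the series of $\psi$ term by term produces the
  factor $w^{-s}\zeta(s)$ (\<open>mellin_dirichlet_sum\<close>).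

  The functional equation comes from Poisson summation for the lattice of step $wx$
  (\<open>poisson_summation_cosine\<close>): as $\hat f$ is its own cosine transform up to normalisation, it
  yields $1 + 2\psi(x) = \frac{1}{x}(1 + 2\psi(1/x))$ (\<open>psi_reciprocal\<close>). Splitting the Mellin
  integral at $1$ and inverting the lower part turns this into
  \[ \eta(s) = \int_1^\infty (x^{s-1} + x^{-s})\,\psi(x)\,dx + \frac{1}{2s(s-1)} \]
  (\<open>mellin_psi_continuation\<close>). The integral is entire because $\psi$ decays faster than every
  power (\<open>entire_integral_powr\<close>), and it is visibly invariant under $s \mapsto 1 - s$.

  Poisson summation itself is proved for even functions that decrease on the half line: the
  periodisation and the cosine series formed from the transform are continuous with equal cosine
  coefficients, and \<open>even_periodic_eq_zero_if_cosine_coefficients_zero\<close> shows that such functions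
  agree.
\<close>

section \<open>Poisson summation for even functions\<close>

text \<open>
  An even function of period $1$ is a function of $u = \cos(2\pi y)$: because of
  \<open>D (1 - y) = D y\<close> the branch of \<open>arccos\<close> does not matter. By the product formula for cosines,
  the hypothesis makes \<open>D\<close> orthogonal to every power of $u$, hence to every polynomial in $u$.
  Such polynomials approximate \<open>D\<close> uniformly by Weierstrass, so the integral of \<open>D\<^sup>2\<close> vanishes.
\<close>

lemma even_periodic_eq_zero_if_cosine_coefficients_zero:
  fixes D :: "real \<Rightarrow> real"
  assumes cont: "continuous_on {0..1} D"
    and sym: "\<And>y. y \<in> {0..1} \<Longrightarrow> D (1 - y) = D y"
    and coeff: "\<And>j::nat. ((\<lambda>y. D y * cos (2 * pi * real j * y)) has_integral 0) {0..1}"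
    and y: "y \<in> {0..1}"
  shows "D y = 0"
proof -
  have moment: "((\<lambda>y. D y * cos (2 * pi * y) ^ m * cos (2 * pi * real j * y)) has_integral 0) {0..1}"
    for m j :: nat
  proof (induction m arbitrary: j)
    case 0
    show ?case using coeff[of j] by simp
  next
    case (Suc m)
    show ?case
    proof (cases j)
      case 0
      then show ?thesis using Suc.IH[of 1] by (simp add: mult_ac)
    next
      case (Suc i)
      have "((\<lambda>y. (D y * cos (2 * pi * y) ^ m * cos (2 * pi * real (i + 2) * y)) / 2
               + (D y * cos (2 * pi * y) ^ m * cos (2 * pi * real i * y)) / 2) has_integral (0 / 2 + 0 / 2)) {0..1}"
        by (intro has_integral_add has_integral_divide Suc.IH)
      moreover have "(D y * cos (2 * pi * y) ^ m * cos (2 * pi * real (i + 2) * y)) / 2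
               + (D y * cos (2 * pi * y) ^ m * cos (2 * pi * real i * y)) / 2
             = D y * cos (2 * pi * y) ^ Suc m * cos (2 * pi * real j * y)" for y
      proof -
        have e1: "2 * pi * real (i + 2) * y = 2 * pi * real j * y + 2 * pi * y"
          and e2: "2 * pi * real i * y = 2 * pi * real j * y - 2 * pi * y"
          using Suc by (auto simp: algebra_simps)
        show ?thesis unfolding e1 e2 cos_add cos_diff by (simp add: field_simps)
      qed
      ultimately show ?thesis by simp
    qed
  qed
  have poly: "((\<lambda>y. D y * p (cos (2 * pi * y))) has_integral 0) {0..1}"
    if p: "real_polynomial_function p" for p
  proof -
    obtain a n where an: "p = (\<lambda>x. \<Sum>i\<le>n. a i * x ^ i)"
      using p real_polynomial_function_iff_sum by blast
    have "((\<lambda>y. \<Sum>i\<le>n. a i * (D y * cos (2 * pi * y) ^ i * cos (2 * pi * real 0 * y))) has_integral (\<Sum>i\<le>n. a i * 0)) {0..1}"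
      by (intro has_integral_sum has_integral_mult_right moment) auto
    then show ?thesis by (simp add: an sum_distrib_left mult_ac)
  qed
  define h where "h = (\<lambda>u. D (arccos u / (2 * pi)))"
  have h_cont: "continuous_on {-1..1} h"
    unfolding h_def
  proof (rule continuous_on_compose2[OF cont])
    show "continuous_on {-1..1} (\<lambda>u. arccos u / (2 * pi))"
      by (intro continuous_intros) auto
    show "(\<lambda>u. arccos u / (2 * pi)) ` {-1..1} \<subseteq> {0..1}"
      using arccos_lbound arccos_ubound by (fastforce simp: field_simps intro: order_trans)
  qed
  have D_eq: "D y = h (cos (2 * pi * y))" if y: "y \<in> {0..1}" for y
  proof (cases "y \<le> 1/2")
    case True
    then have "arccos (cos (2 * pi * y)) = 2 * pi * y"
      using y by (intro arccos_cos) auto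
    then show ?thesis by (simp add: h_def)
  next
    case False
    have "cos (2 * pi * y) = cos (2 * pi * (1 - y))"
      by (simp add: algebra_simps cos_diff)
    moreover have "arccos (cos (2 * pi * (1 - y))) = 2 * pi * (1 - y)"
      using y False by (intro arccos_cos) auto
    ultimately show ?thesis using sym[OF y] by (simp add: h_def)
  qed
  define J where "J = integral {0..1} (\<lambda>y. \<bar>D y\<bar>)"
  have J: "((\<lambda>y. \<bar>D y\<bar>) has_integral J) {0..1}"
    unfolding J_def using cont by (intro integrable_integral integrable_continuous_real continuous_intros)
  define Q where "Q = integral {0..1} (\<lambda>y. D y * D y)"
  have Q: "((\<lambda>y. D y * D y) has_integral Q) {0..1}"
    unfolding Q_def using cont by (intro integrable_integral integrable_continuous_real continuous_intros)
  have J0: "J \<ge> 0" using has_integral_nonneg[OF J] by simp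
  have Q0: "Q \<ge> 0" using has_integral_nonneg[OF Q] by simp
  have small: "Q \<le> e * J" if e: "e > 0" for e
  proof -
    obtain p where p: "real_polynomial_function p" "\<And>x. x \<in> {-1..1} \<Longrightarrow> \<bar>h x - p x\<bar> < e"
      using Stone_Weierstrass_real_polynomial_function[OF compact_Icc h_cont e] by blast
    have "((\<lambda>y. D y * D y - D y * p (cos (2 * pi * y))) has_integral (Q - 0)) {0..1}"
      by (intro has_integral_diff Q poly p)
    moreover have "D y * D y - D y * p (cos (2 * pi * y)) \<le> e * \<bar>D y\<bar>" if y: "y \<in> {0..1}" for y
    proof -
      have "\<bar>D y * (D y - p (cos (2 * pi * y)))\<bar> \<le> \<bar>D y\<bar> * e"
        unfolding abs_mult using p(2)[of "cos (2 * pi * y)"] D_eq[OF y]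
        by (intro mult_left_mono) auto
      then show ?thesis by (simp add: algebra_simps)
    qed
    ultimately show ?thesis
      using has_integral_le[OF _ has_integral_mult_right[OF J, of e]] by fastforce
  qed
  have "Q \<le> 0"
  proof (rule field_le_epsilon)
    fix e :: real assume e: "0 < e"
    (* J + 1 instead of J keeps the denominator positive. *)
    have "Q \<le> e / (J + 1) * J" using e J0 by (intro small) auto
    also have "\<dots> \<le> e" using e J0 by (simp add: field_simps)
    finally show "Q \<le> 0 + e" by simp
  qed
  then have Q_zero: "Q = 0" using Q0 by simp
  have "D y * D y = 0"
    by (rule has_integral_0_cbox_imp_0[of 0 1 "\<lambda>y. D y * D y"])
       (use cont Q Q_zero y in \<open>auto intro!: continuous_intros\<close>)
  then show ?thesis by simp
qed

lemma has_integral_suminf_Icc: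
  fixes f :: "nat \<Rightarrow> real \<Rightarrow> real"
  assumes cont: "\<And>n. continuous_on {a..b} (f n)"
    and bound: "\<And>n x. x \<in> {a..b} \<Longrightarrow> \<bar>f n x\<bar> \<le> M n"
    and M: "summable M"
    and I: "\<And>n. (f n has_integral I n) {a..b}"
    and J: "I sums J"
  shows "((\<lambda>x. \<Sum>n. f n x) has_integral J) {a..b}"
proof -
  have unif: "uniform_limit {a..b} (\<lambda>n x. \<Sum>i<n. f i x) (\<lambda>x. \<Sum>i. f i x) sequentially"
    by (rule Weierstrass_m_test[OF _ M]) (use bound in auto)
  have part: "continuous_on {a..b} (\<lambda>x. \<Sum>i<n. f i x)" for n
    by (intro continuous_on_sum cont)
  show ?thesis
  proof (rule uniform_limit_integral[OF unif part sequentially_bot])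
    fix I' J'
    assume *: "\<And>n. ((\<lambda>x. \<Sum>i<n. f i x) has_integral I' n) {a..b}"
      "((\<lambda>x. \<Sum>n. f n x) has_integral J') {a..b}" "I' \<longlonglongrightarrow> J'"
    have "I' = (\<lambda>n. \<Sum>i<n. I i)"
      by (intro ext has_integral_unique[OF *(1)] has_integral_sum I) auto
    then have "J' = J"
      using *(3) J LIMSEQ_unique unfolding sums_def by blast
    then show ?thesis using *(2) by simp
  qed
qed

lemma continuous_on_suminf_Icc:
  fixes f :: "nat \<Rightarrow> real \<Rightarrow> real"
  assumes cont: "\<And>n. continuous_on {a..b} (f n)"
    and bound: "\<And>n x. x \<in> {a..b} \<Longrightarrow> \<bar>f n x\<bar> \<le> M n"
    and M: "summable M"
  shows "continuous_on {a..b} (\<lambda>x. \<Sum>n. f n x)"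
proof (rule uniform_limit_theorem)
  show "uniform_limit {a..b} (\<lambda>n x. \<Sum>i<n. f i x) (\<lambda>x. \<Sum>i. f i x) sequentially"
    by (rule Weierstrass_m_test[OF _ M]) (use bound in auto)
qed (auto intro!: always_eventually continuous_on_sum cont)

lemma has_integral_cos_unit_interval:
  fixes m :: int
  shows "((\<lambda>y. cos (2 * pi * m * y)) has_integral (if m = 0 then 1 else 0)) {0..1}"
proof (cases "m = 0")
  case True
  then show ?thesis using has_integral_const_real[of "1::real" 0 1] by simp
next
  case False
  have "((\<lambda>y. cos (2 * pi * m * y)) has_integral
      (sin (2 * pi * m * 1) / (2 * pi * m) - sin (2 * pi * m * 0) / (2 * pi * m))) {0..1}"
    using False
    by (intro fundamental_theorem_of_calculus)
       (auto intro!: derivative_eq_intros simp flip: has_real_derivative_iff_has_vector_derivative)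
  moreover have "sin (2 * pi * m) = 0"
    by (metis sin_int_2pin)
  ultimately show ?thesis using False by simp
qed

lemma has_integral_cos_cos_unit_interval:
  fixes k j :: nat
  shows "((\<lambda>y. cos (2 * pi * real k * y) * cos (2 * pi * real j * y)) has_integral
          (if k = j then if j = 0 then 1 else 1/2 else 0)) {0..1}"
proof -
  have "((\<lambda>y. cos (2 * pi * of_int (int k - int j) * y) / 2 + cos (2 * pi * of_int (int k + int j) * y) / 2) has_integral
      ((if int k - int j = 0 then 1 else 0) / 2 + (if int k + int j = 0 then 1 else 0) / 2)) {0..1}"
    by (intro has_integral_add has_integral_divide has_integral_cos_unit_interval)
  moreover have "cos (2 * pi * of_int (int k - int j) * y) / 2 + cos (2 * pi * of_int (int k + int j) * y) / 2
     = cos (2 * pi * real k * y) * cos (2 * pi * real j * y)" for y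
    using cos_times_cos[of "2 * pi * real k * y" "2 * pi * real j * y"] by (simp add: algebra_simps add_divide_distrib)
  moreover have "((if int k - int j = 0 then 1 else 0) / 2 + (if int k + int j = 0 then 1 else 0) / 2)
     = (if k = j then if j = 0 then 1 else 1/2 else (0::real))" by auto
  ultimately show ?thesis by simp
qed

text \<open>
  The periodisation \<open>F\<close> of \<open>h\<close> (extended evenly) and the cosine series \<open>S\<close> with
  coefficients \<open>c\<close> are both continuous, by the Weierstrass test: \<open>F\<close> because monotonicity bounds
  its terms by values of \<open>h\<close> at integers, \<open>S\<close> because \<open>c\<close> is absolutely summable. Unfolding the
  periodisation shows that they have the same cosine coefficients, so they agree everywhere, and
  the formula is their equality at $0$.
\<close>

lemma poisson_summation_cosine:
  fixes h :: "real \<Rightarrow> real" and c :: "nat \<Rightarrow> real"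
  assumes cont: "continuous_on UNIV h"
    and nonneg: "\<And>x. 0 \<le> h x"
    and anti: "antimono_on {0..} h"
    and int: "set_integrable lborel {0..} h"
    and sumh: "summable (\<lambda>n. h (real n))"
    and c: "\<And>k. c k = 2 * (LBINT x:{0..}. h x * cos (2 * pi * real k * x))"
    and sumc: "summable (\<lambda>k. \<bar>c k\<bar>)"
  shows "h 0 + 2 * (\<Sum>n. h (real (Suc n))) = c 0 + 2 * (\<Sum>k. c (Suc k))"
proof -
  (* The terms h (n + y) and h (n + 1 - y) are those with index n and - (n + 1) in the
     two-sided sum of the even extension of h; both arguments are nonnegative on {0..1}. *)
  define A where "A = (\<lambda>(n::nat) y. h (real n + y) + h (real n + 1 - y))"
  define F where "F = (\<lambda>y. \<Sum>n. A n y)"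
  (* The cosine terms with indices k and - k coincide, which doubles all but the constant one. *)
  define d where "d = (\<lambda>k::nat. if k = 0 then c 0 else 2 * c k)"
  define S where "S = (\<lambda>y. \<Sum>k. d k * cos (2 * pi * real k * y))"
  have cont': "continuous_on X h" for X using cont continuous_on_subset by blast
  have A_cont: "continuous_on {0..1} (A n)" for n
    unfolding A_def by (intro continuous_intros continuous_on_compose2[OF cont]) auto
  have A_bound: "\<bar>A n y\<bar> \<le> 2 * h (real n)" if "y \<in> {0..1}" for n y
  proof -
    have "h (real n + y) \<le> h (real n)" "h (real n + 1 - y) \<le> h (real n)"
      using that by (auto intro!: monotone_onD[OF anti])
    then show ?thesis using nonneg by (simp add: A_def)
  qed
  have A_int: "((\<lambda>y. A n y * cos (2 * pi * real j * y)) has_integral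
       (2 * integral {real n..real n + 1} (\<lambda>x. h x * cos (2 * pi * real j * x)))) {0..1}" for n j
  proof -
    let ?g = "\<lambda>x. h x * cos (2 * pi * real j * x)"
    define I where "I = integral {real n..real n + 1} ?g"
    have I: "(?g has_integral I) (cbox (real n) (real n + 1))"
      unfolding I_def cbox_interval
      by (intro integrable_integral integrable_continuous_real continuous_intros cont')
    have i1: "(\<lambda>x. (1 / 1) *\<^sub>R x + - ((1 / 1) *\<^sub>R real n)) ` cbox (real n) (real n + 1) = {0..1}"
      unfolding cbox_interval
      by (auto simp: image_iff intro!: bexI[of _ "_ + real n"])
    have i2: "(\<lambda>x. (1 / -1) *\<^sub>R x + - ((1 / -1) *\<^sub>R (real n + 1))) ` cbox (real n) (real n + 1) = {0..1}"
      unfolding cbox_interval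
      by (auto simp: image_iff intro!: bexI[of _ "real n + 1 - _"])
    have p1: "?g (1 * y + real n) = h (real n + y) * cos (2 * pi * real j * y)" for y
    proof -
      have "cos (2 * pi * real j * (1 * y + real n)) = cos (2 * pi * real j * y + 2 * pi * real (j * n))"
        by (simp add: algebra_simps)
      also have "\<dots> = cos (2 * pi * real j * y)"
        by (metis cos_add cos_int_2pin sin_int_2pin of_int_of_nat_eq mult_zero_right diff_zero mult.right_neutral)
      finally show ?thesis by (simp add: add.commute)
    qed
    have p2: "?g (-1 * y + (real n + 1)) = h (real n + 1 - y) * cos (2 * pi * real j * y)" for y
    proof -
      have "cos (2 * pi * real j * (-1 * y + (real n + 1))) = cos (2 * pi * real j * y - 2 * pi * real (j * (n + 1)))"
        by (subst cos_minus[symmetric]) (simp add: algebra_simps)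
      also have "\<dots> = cos (2 * pi * real j * y)"
        by (metis cos_diff cos_int_2pin sin_int_2pin of_int_of_nat_eq mult_zero_right add_0_right mult.right_neutral)
      finally show ?thesis by (simp add: algebra_simps)
    qed
    have "((\<lambda>y. h (real n + y) * cos (2 * pi * real j * y)) has_integral I) {0..1}"
      using has_integral_affinity[OF I, of 1 "real n"] unfolding i1 p1[symmetric] by simp
    moreover have "((\<lambda>y. h (real n + 1 - y) * cos (2 * pi * real j * y)) has_integral I) {0..1}"
      using has_integral_affinity[OF I, of "-1" "real n + 1"] i2 unfolding p2[symmetric] by simp
    ultimately have "((\<lambda>y. h (real n + y) * cos (2 * pi * real j * y) + h (real n + 1 - y) * cos (2 * pi * real j * y)) has_integral (I + I)) {0..1}"
      by (rule has_integral_add)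
    then show ?thesis by (simp add: A_def I_def algebra_simps)
  qed
  have c_sums: "(\<lambda>n. 2 * integral {real n..real n + 1} (\<lambda>x. h x * cos (2 * pi * real j * x))) sums c j" for j
  proof -
    let ?g = "\<lambda>x. h x * cos (2 * pi * real j * x)"
    have g_cont: "continuous_on X ?g" for X by (intro continuous_intros cont')
    have g_int: "set_integrable lborel {0..} ?g"
    proof (rule set_integrable_bound[OF int])
      show "set_borel_measurable lborel {0..} ?g"
        unfolding set_borel_measurable_def using g_cont
        by (intro borel_measurable_scaleR) (auto intro!: borel_measurable_continuous_onI)
      show "AE x in lborel. x \<in> {0..} \<longrightarrow> norm (?g x) \<le> norm (h x)"
        by (auto simp: abs_mult mult_left_le)
    qed
    have part: "(\<Sum>n<N. integral {real n..real n + 1} ?g) = (LBINT x:{0..real N}. ?g x)" for N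
    proof -
      have "(\<Sum>n<N. integral {real n..real n + 1} ?g) = integral {0..real N} ?g"
      proof (induction N)
        case (Suc N)
        have "integral {0..real N} ?g + integral {real N..real N + 1} ?g = integral {0..real N + 1} ?g"
          by (rule Henstock_Kurzweil_Integration.integral_combine)
             (auto intro!: integrable_continuous_real g_cont)
        then show ?case using Suc by (simp add: add.commute)
      qed simp
      also have "\<dots> = (LBINT x:{0..real N}. ?g x)"
        by (intro set_borel_integral_eq_integral(2)[symmetric] borel_integrable_atLeastAtMost' g_cont)
      finally show ?thesis .
    qed
    have "((\<lambda>b. LBINT x:{0..b}. ?g x) \<longlongrightarrow> (LBINT x:{0..}. ?g x)) at_top"
      by (rule tendsto_set_lebesgue_integral_at_top[OF _ g_int]) auto
    then have "(\<lambda>N. LBINT x:{0..real N}. ?g x) \<longlonglongrightarrow> (LBINT x:{0..}. ?g x)"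
      by (rule filterlim_compose[OF _ filterlim_real_sequentially])
    then have "(\<lambda>n. integral {real n..real n + 1} ?g) sums (LBINT x:{0..}. ?g x)"
      unfolding sums_def part .
    then show ?thesis unfolding c by (rule sums_mult)
  qed
  have sum2h: "summable (\<lambda>n. 2 * h (real n))" using sumh by (rule summable_mult)
  have F_coeff: "((\<lambda>y. F y * cos (2 * pi * real j * y)) has_integral c j) {0..1}" for j
  proof -
    have "((\<lambda>y. \<Sum>n. A n y * cos (2 * pi * real j * y)) has_integral c j) {0..1}"
    proof (rule has_integral_suminf_Icc[OF _ _ sum2h A_int c_sums])
      show "continuous_on {0..1} (\<lambda>y. A n y * cos (2 * pi * real j * y))" for n
        by (intro continuous_intros A_cont)
      show "\<bar>A n y * cos (2 * pi * real j * y)\<bar> \<le> 2 * h (real n)" if "y \<in> {0..1}" for n y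
        using mult_mono[OF A_bound[OF that, of n] abs_cos_le_one[of "2 * pi * real j * y"]] nonneg
        by (simp add: abs_mult)
    qed
    moreover have "(\<Sum>n. A n y * cos (2 * pi * real j * y)) = F y * cos (2 * pi * real j * y)" if "y \<in> {0..1}" for y
      unfolding F_def using A_bound[OF that]
      by (intro suminf_mult2[symmetric] summable_comparison_test'[OF sum2h, of 0]) auto
    ultimately show ?thesis using has_integral_cong by (metis (no_types, lifting))
  qed
  have sumd: "summable (\<lambda>k. \<bar>d k\<bar>)"
    by (rule summable_comparison_test'[OF summable_mult[OF sumc, of 2], of 0]) (auto simp: d_def)
  have S_coeff: "((\<lambda>y. S y * cos (2 * pi * real j * y)) has_integral c j) {0..1}" for j
  proof -
    let ?I = "\<lambda>k. d k * (if k = j then if j = 0 then 1 else 1/2 else 0)"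
    have "((\<lambda>y. \<Sum>k. d k * (cos (2 * pi * real k * y) * cos (2 * pi * real j * y))) has_integral c j) {0..1}"
    proof (rule has_integral_suminf_Icc[OF _ _ sumd])
      show "((\<lambda>y. d k * (cos (2 * pi * real k * y) * cos (2 * pi * real j * y))) has_integral ?I k) {0..1}" for k
        by (intro has_integral_mult_right has_integral_cos_cos_unit_interval)
      have "?I = (\<lambda>k. if k = j then c j else 0)" by (auto simp: d_def)
      then show "?I sums c j" using sums_single[of j "\<lambda>_. c j"] by simp
      show "\<bar>d k * (cos (2 * pi * real k * y) * cos (2 * pi * real j * y))\<bar> \<le> \<bar>d k\<bar>" for k y
        using mult_mono[OF abs_cos_le_one[of "2 * pi * real k * y"] abs_cos_le_one[of "2 * pi * real j * y"]]
        by (auto simp: abs_mult intro!: mult_left_le)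
    qed (intro continuous_intros)
    moreover have "(\<Sum>k. d k * (cos (2 * pi * real k * y) * cos (2 * pi * real j * y))) = S y * cos (2 * pi * real j * y)" for y
    proof -
      have "summable (\<lambda>k. d k * cos (2 * pi * real k * y))"
        by (rule summable_comparison_test'[OF sumd, of 0]) (auto simp: abs_mult intro!: mult_left_le)
      from suminf_mult2[OF this] show ?thesis by (simp add: S_def mult.assoc)
    qed
    ultimately show ?thesis by simp
  qed
  have S_cont: "continuous_on {0..1} S"
    unfolding S_def
    by (rule continuous_on_suminf_Icc[OF _ _ sumd])
       (auto intro!: continuous_intros mult_left_le simp: abs_mult)
  have F_cont: "continuous_on {0..1} F"
    unfolding F_def by (rule continuous_on_suminf_Icc[OF A_cont A_bound sum2h])
  have "F 0 - S 0 = 0"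
  proof (rule even_periodic_eq_zero_if_cosine_coefficients_zero[where D = "\<lambda>y. F y - S y" and y = 0])
    show "continuous_on {0..1} (\<lambda>y. F y - S y)" by (intro continuous_intros F_cont S_cont)
    show "((\<lambda>y. (F y - S y) * cos (2 * pi * real j * y)) has_integral 0) {0..1}" for j
      using has_integral_diff[OF F_coeff[of j] S_coeff[of j]] by (simp add: left_diff_distrib)
    show "F (1 - y) - S (1 - y) = F y - S y" for y
    proof -
      have "A n (1 - y) = A n y" for n by (simp add: A_def algebra_simps)
      moreover have "cos (2 * pi * real k * (1 - y)) = cos (2 * pi * real k * y)" for k
      proof -
        have "cos (2 * pi * real k * (1 - y)) = cos (2 * pi * real k - 2 * pi * real k * y)"
          by (simp add: algebra_simps)
        also have "\<dots> = cos (2 * pi * real k * y)"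
          using cos_int_2pin[of "int k"] sin_int_2pin[of "int k"] by (simp add: cos_diff)
        finally show ?thesis .
      qed
      ultimately show ?thesis by (simp add: F_def S_def)
    qed
  qed auto
  moreover have "F 0 = h 0 + 2 * (\<Sum>n. h (real (Suc n)))"
  proof -
    have s: "summable (\<lambda>n. h (real (Suc n)))" using sumh summable_Suc_iff[of "\<lambda>n. h (real n)"] by simp
    have "F 0 = (\<Sum>n. h (real n)) + (\<Sum>n. h (real (Suc n)))"
      using suminf_add[OF sumh s] by (simp add: F_def A_def add.commute)
    also have "(\<Sum>n. h (real n)) = h 0 + (\<Sum>n. h (real (Suc n)))"
      using suminf_split_head[OF sumh] by simp
    finally show ?thesis by simp
  qed
  moreover have "S 0 = c 0 + 2 * (\<Sum>k. c (Suc k))"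
  proof -
    have "summable c" using sumc by (rule summable_rabs_cancel)
    then have s: "summable (\<lambda>k. c (Suc k))" using summable_Suc_iff[of c] by simp
    have "S 0 = d 0 + (\<Sum>k. d (Suc k))"
      using suminf_split_head[OF summable_rabs_cancel[OF sumd]] by (simp add: S_def)
    also have "(\<Sum>k. d (Suc k)) = 2 * (\<Sum>k. c (Suc k))"
      using suminf_mult[OF s, of 2] by (simp add: d_def)
    finally show ?thesis by (simp add: d_def)
  qed
  ultimately show ?thesis by simp
qed

section \<open>Mellin transforms\<close>

lemma set_integrable_powr_mult_of_moments:
  fixes g :: "real \<Rightarrow> complex"
  assumes [measurable]: "g \<in> borel_measurable borel"
    and int: "\<And>k::nat. set_integrable lborel {1..} (\<lambda>x. x ^ k *\<^sub>R g x)"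
  shows "set_integrable lborel {1..} (\<lambda>x. of_real x powr s * g x)"
proof -
  define k where "k = nat \<lceil>Re s\<rceil>"
  have k: "Re s \<le> real k" unfolding k_def by linarith
  show ?thesis
  proof (rule set_integrable_bound[OF int[of k]])
    show "set_borel_measurable lborel {1..} (\<lambda>x. of_real x powr s * g x)"
      unfolding set_borel_measurable_def by measurable
    show "AE x in lborel. x \<in> {1..} \<longrightarrow> norm (of_real x powr s * g x) \<le> norm (x ^ k *\<^sub>R g x)"
    proof (intro always_eventually allI impI)
      fix x :: real assume x: "x \<in> {1..}"
      have "norm (complex_of_real x powr s) = x powr Re s"
        using x by (subst norm_powr_real_powr) auto
      also have "\<dots> \<le> x powr real k" using x k by (intro powr_mono) auto
      also have "\<dots> = x ^ k" using x by (simp add: powr_realpow)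
      finally show "norm (of_real x powr s * g x) \<le> norm (x ^ k *\<^sub>R g x)"
        using x by (simp add: norm_mult mult_right_mono)
    qed
  qed
qed

lemma power_div_fact_le_exp:
  fixes t :: real
  assumes "0 \<le> t"
  shows "(\<Sum>n<N. t ^ n / fact n) \<le> exp t"
proof -
  have "(\<lambda>n. t ^ n / fact n) sums exp t"
    using exp_converges[of t] by (simp add: divide_inverse mult.commute)
  then show ?thesis
    using assms sum_le_suminf[of "\<lambda>n. t ^ n / fact n" "{..<N}"] by (auto simp: sums_iff)
qed

text \<open>
  Expand $x^s = \sum_n s^n (\log x)^n / n!$ under the integral. The partial sums are dominated by
  $x^k |g(x)|$ for any integer $k \ge |s|$, so term-by-term integration is justified and the
  integral is a power series in $s$ converging on the whole plane.
\<close>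

lemma entire_integral_powr:
  fixes g :: "real \<Rightarrow> complex"
  assumes g[measurable]: "g \<in> borel_measurable borel"
    and int: "\<And>k::nat. set_integrable lborel {1..} (\<lambda>x. x ^ k *\<^sub>R g x)"
  shows "(\<lambda>s. CLBINT x:{1..}. of_real x powr s * g x) holomorphic_on UNIV"
proof -
  define E where "E = (\<lambda>s. CLBINT x:{1..}. of_real x powr s * g x)"
  define f where "f = (\<lambda>(n::nat) (x::real). indicator {1..} x *\<^sub>R (of_real (ln x ^ n / fact n) * g x))"
  define a where "a = (\<lambda>n. integral\<^sup>L lborel (f n))"
  have f_int: "integrable lborel (f n)" for n
  proof (rule Bochner_Integration.integrable_bound[OF int[of 1, unfolded set_integrable_def]])
    show "f n \<in> borel_measurable lborel" unfolding f_def by measurable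
    show "AE x in lborel. norm (f n x) \<le> norm (indicator {1..} x *\<^sub>R (x ^ 1 *\<^sub>R g x))"
    proof (intro always_eventually allI)
      fix x :: real
      show "norm (f n x) \<le> norm (indicator {1..} x *\<^sub>R (x ^ 1 *\<^sub>R g x))"
      proof (cases "1 \<le> x")
        case True
        have "ln x ^ n / fact n \<le> (\<Sum>m<Suc n. ln x ^ m / fact m)"
          using True by (intro member_le_sum) auto
        also have "\<dots> \<le> exp (ln x)" using True by (intro power_div_fact_le_exp) auto
        finally have "ln x ^ n / fact n \<le> x" using True by simp
        then show ?thesis using True
            mult_right_mono[of "ln x ^ n / fact n" x "norm (g x)"]
          by (simp add: f_def norm_mult norm_divide norm_power)
      qed (simp add: f_def)
    qed
  qed
  have series: "(\<lambda>n. a n * (s - 0) ^ n) sums E s" for s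
  proof -
    define k where "k = nat \<lceil>norm s\<rceil>"
    have k: "norm s \<le> real k" unfolding k_def by linarith
    define F where "F = (\<lambda>n x. f n x * s ^ n)"
    have F_sums: "(\<lambda>n. F n x) sums (indicator {1..} x *\<^sub>R (of_real x powr s * g x))" for x
    proof (cases "1 \<le> x")
      case True
      have "(\<lambda>n. (s * of_real (ln x)) ^ n /\<^sub>R fact n * g x) sums (exp (s * of_real (ln x)) * g x)"
        by (intro sums_mult2 exp_converges)
      moreover have "exp (s * of_real (ln x)) = of_real x powr s"
        using True by (simp add: powr_def Ln_of_real)
      ultimately show ?thesis using True
        by (simp add: F_def f_def power_mult_distrib scaleR_conv_of_real field_simps)
    qed (simp add: F_def f_def)
    have F_part: "(\<Sum>n<N. norm (F n x)) \<le> norm (indicator {1..} x *\<^sub>R (x ^ k *\<^sub>R g x))" for x N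
    proof (cases "1 \<le> x")
      case True
      have "(\<Sum>n<N. norm (F n x)) = (\<Sum>n<N. (norm s * ln x) ^ n / fact n) * norm (g x)"
        unfolding sum_distrib_right using True
        by (intro sum.cong) (simp_all add: F_def f_def norm_mult norm_divide norm_power power_mult_distrib)
      also have "(\<Sum>n<N. (norm s * ln x) ^ n / fact n) \<le> exp (norm s * ln x)"
        using True by (intro power_div_fact_le_exp) auto
      also have "exp (norm s * ln x) = x powr norm s" using True by (simp add: powr_def)
      also have "\<dots> \<le> x powr real k" using True k by (intro powr_mono) auto
      also have "\<dots> = x ^ k" using True by (simp add: powr_realpow)
      finally show ?thesis using True by (simp add: mult_right_mono)
    qed (simp add: F_def f_def)
    have F_int: "integrable lborel (F n)" for n
      unfolding F_def by (intro integrable_mult_left f_int)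
    have "(\<lambda>n. integral\<^sup>L lborel (F n)) sums (\<integral>x. (\<Sum>n. F n x) \<partial>lborel)"
    proof (rule sums_integral[OF F_int])
      show "AE x in lborel. summable (\<lambda>n. norm (F n x))"
        using F_part by (intro always_eventually allI summableI_nonneg_bounded) auto
      show "summable (\<lambda>n. \<integral>x. norm (F n x) \<partial>lborel)"
      proof (rule summableI_nonneg_bounded)
        fix N
        have "(\<Sum>n<N. \<integral>x. norm (F n x) \<partial>lborel) = (\<integral>x. (\<Sum>n<N. norm (F n x)) \<partial>lborel)"
          by (intro Bochner_Integration.integral_sum[symmetric] integrable_norm F_int)
        also have "\<dots> \<le> (\<integral>x. norm (indicator {1..} x *\<^sub>R (x ^ k *\<^sub>R g x)) \<partial>lborel)"
          using int[of k] F_part unfolding set_integrable_def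
          by (intro integral_mono integrable_norm Bochner_Integration.integrable_sum F_int)
        finally show "(\<Sum>n<N. \<integral>x. norm (F n x) \<partial>lborel) \<le> \<dots>" .
      qed simp
    qed
    moreover have "integral\<^sup>L lborel (F n) = a n * (s - 0) ^ n" for n
      by (simp add: F_def a_def)
    moreover have "(\<integral>x. (\<Sum>n. F n x) \<partial>lborel) = E s"
      using sums_unique[OF F_sums] by (simp add: E_def set_lebesgue_integral_def)
    ultimately show ?thesis by simp
  qed
  have "E field_differentiable (at s)" for s
  proof (rule holomorphic_on_imp_differentiable_at)
    show "E holomorphic_on ball 0 (norm s + 1)"
      by (rule power_series_holomorphic) (rule series)
  qed auto
  then show ?thesis
    unfolding E_def[symmetric] holomorphic_on_def by (auto intro: field_differentiable_at_within)
qed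

text \<open>
  Substituting $x \mapsto cx$. The third part, on the integral of the absolute value, is what makes
  the interchange of sum and integral in the next lemma possible.
\<close>

lemma mellin_dilate:
  fixes g :: "real \<Rightarrow> complex"
  assumes c: "c > 0" and g: "mellin_convergent g s"
  shows "mellin_convergent (\<lambda>x. g (c * x)) s"
    and "mellin (\<lambda>x. g (c * x)) s = of_real c powr (-s) * mellin g s"
    and "(\<integral>x. norm (indicator {0<..} x *\<^sub>R (of_real x powr (s - 1) * g (c * x))) \<partial>lborel)
        = c powr (- Re s) * (\<integral>x. norm (indicator {0<..} x *\<^sub>R (of_real x powr (s - 1) * g x)) \<partial>lborel)"
proof -
  define G where "G x = indicator {0<..} x *\<^sub>R (complex_of_real x powr (s - 1) * g x)" for x
  define H where "H x = indicator {0<..} x *\<^sub>R (complex_of_real x powr (s - 1) * g (c * x))" for x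
  have H: "H x = of_real c powr (1 - s) * G (0 + c * x)" for x
  proof (cases "0 < x")
    case True
    have "complex_of_real (c * x) powr (s - 1) = of_real c powr (s - 1) * of_real x powr (s - 1)"
      using c True by (simp add: powr_times_real)
    moreover have "of_real c powr (1 - s) * of_real c powr (s - 1) = (1::complex)"
      using c by (simp flip: powr_add)
    ultimately show ?thesis using c True by (simp add: H_def G_def mult.assoc[symmetric])
  next
    case False
    then show ?thesis using c by (simp add: H_def G_def zero_less_mult_iff)
  qed
  have G_int: "integrable lborel G"
    using g by (simp add: mellin_convergent_def set_integrable_def flip: G_def)
  have "integrable lborel H"
    unfolding H using c G_int by (intro integrable_mult_right lborel_integrable_real_affine) auto
  then show "mellin_convergent (\<lambda>x. g (c * x)) s"
    by (simp add: mellin_convergent_def set_integrable_def flip: H_def)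
  have "integral\<^sup>L lborel G = c *\<^sub>R (\<integral>x. G (0 + c * x) \<partial>lborel)"
    using lborel_integral_real_affine[of c G 0] c by simp
  moreover have "integral\<^sup>L lborel H = of_real c powr (1 - s) * (\<integral>x. G (0 + c * x) \<partial>lborel)"
    unfolding H by simp
  moreover have "of_real c powr (1 - s) = of_real c * of_real c powr (- s)"
    using c by (simp add: powr_diff powr_minus field_simps)
  ultimately show "mellin (\<lambda>x. g (c * x)) s = of_real c powr (-s) * mellin g s"
    unfolding mellin_def set_lebesgue_integral_def H_def[symmetric] G_def[symmetric]
    by (simp add: scaleR_conv_of_real)
  have "(\<integral>x. norm (G x) \<partial>lborel) = c * (\<integral>x. norm (G (0 + c * x)) \<partial>lborel)"
    using lborel_integral_real_affine[of c "\<lambda>x. norm (G x)" 0] c by simp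
  moreover have "(\<integral>x. norm (H x) \<partial>lborel) = c powr (1 - Re s) * (\<integral>x. norm (G (0 + c * x)) \<partial>lborel)"
    using c unfolding H norm_mult by (simp add: norm_powr_real_powr)
  moreover have "c powr (1 - Re s) = c * c powr (- Re s)"
    using c by (simp add: powr_diff powr_minus field_simps)
  ultimately show "(\<integral>x. norm (indicator {0<..} x *\<^sub>R (of_real x powr (s - 1) * g (c * x))) \<partial>lborel)
        = c powr (- Re s) * (\<integral>x. norm (indicator {0<..} x *\<^sub>R (of_real x powr (s - 1) * g x)) \<partial>lborel)"
    unfolding H_def[symmetric] G_def[symmetric] by simp
qed

text \<open>
  Dilation by $b(n+1)$ multiplies the Mellin transform by $(b(n+1))^{-s}$, and the sum of these
  factors is $b^{-s}\zeta(s)$. The condition \<open>Re s > 1\<close> makes the sum of the integrals of the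
  absolute values finite, which allows exchanging sum and integral.
\<close>

lemma mellin_dirichlet_sum:
  fixes g :: "real \<Rightarrow> complex"
  assumes b: "b > 0" and s: "Re s > 1" and g: "mellin_convergent g s"
    and summ: "\<And>x. x > 0 \<Longrightarrow> summable (\<lambda>n. norm (g (b * x * real (Suc n))))"
  shows "mellin_convergent (\<lambda>x. \<Sum>n. g (b * x * real (Suc n))) s"
    and "mellin (\<lambda>x. \<Sum>n. g (b * x * real (Suc n))) s = of_real (1 / b) powr s * zeta s * mellin g s"
proof -
  define c where "c = (\<lambda>n. b * real (Suc n))"
  have c: "c n > 0" for n using b by (simp add: c_def)
  define f where "f = (\<lambda>n x. indicator {0<..} x *\<^sub>R (complex_of_real x powr (s - 1) * g (c n * x)))"
  define K where "K = (\<integral>x. norm (indicator {0<..} x *\<^sub>R (complex_of_real x powr (s - 1) * g x)) \<partial>lborel)"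
  have eq: "b * x * real (Suc n) = c n * x" for x n by (simp add: c_def)
  have f_int: "integrable lborel (f n)" for n
    using mellin_dilate(1)[OF c g, of n] by (simp add: f_def mellin_convergent_def set_integrable_def)
  have summable_powr: "summable (\<lambda>n. real (Suc n) powr (- Re s))"
    using s summable_Suc_iff[of "\<lambda>n. real n powr (- Re s)"] summable_real_powr_iff[of "- Re s"] by simp
  have f_summable: "AE x in lborel. summable (\<lambda>n. norm (f n x))"
  proof (intro always_eventually allI)
    fix x show "summable (\<lambda>n. norm (f n x))"
    proof (cases "0 < x")
      case True
      then show ?thesis using summable_mult[OF summ[OF True], of "norm (complex_of_real x powr (s - 1))"] True
        unfolding f_def norm_mult eq by (simp add: norm_mult)
    qed (simp add: f_def)
  qed
  have norm_summable: "summable (\<lambda>n. \<integral>x. norm (f n x) \<partial>lborel)"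
  proof -
    have "(\<integral>x. norm (f n x) \<partial>lborel) = real (Suc n) powr (- Re s) * (b powr (- Re s) * K)" for n
      unfolding f_def K_def mellin_dilate(3)[OF c g, of n] using b
      by (simp add: c_def powr_mult)
    then show ?thesis using summable_mult2[OF summable_powr] by simp
  qed
  have sum_eq: "(\<Sum>n. f n x) = indicator {0<..} x *\<^sub>R (of_real x powr (s - 1) * (\<Sum>n. g (b * x * real (Suc n))))" for x
  proof (cases "0 < x")
    case True
    then show ?thesis
      using suminf_mult[OF summable_norm_cancel[OF summ[OF True]], of "complex_of_real x powr (s - 1)"]
      by (simp add: f_def eq del: of_nat_Suc)
  qed (simp add: f_def)
  show "mellin_convergent (\<lambda>x. \<Sum>n. g (b * x * real (Suc n))) s"
    using integrable_suminf[OF f_int f_summable norm_summable]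
    by (simp add: sum_eq mellin_convergent_def set_integrable_def)
  have "mellin (\<lambda>x. \<Sum>n. g (b * x * real (Suc n))) s = (\<Sum>n. integral\<^sup>L lborel (f n))"
    using integral_suminf[OF f_int f_summable norm_summable]
    by (simp add: sum_eq mellin_def set_lebesgue_integral_def)
  also have "\<dots> = (\<Sum>n. (1 / of_nat (Suc n) powr s) * (of_real (1 / b) powr s * mellin g s))"
  proof (rule suminf_cong)
    fix n
    have "integral\<^sup>L lborel (f n) = of_real (c n) powr (- s) * mellin g s"
      using mellin_dilate(2)[OF c g, of n] by (simp add: f_def mellin_def set_lebesgue_integral_def)
    also have "of_real (c n) powr (- s) = of_real b powr (- s) * complex_of_real (real (Suc n)) powr (- s)"
      unfolding c_def of_real_mult using b by (subst powr_times_real) auto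
    also have "of_real b powr (- s) = of_real (1 / b) powr s"
    proof -
      have "of_real (1 / b) powr s = of_real (b powr (- 1)) powr s"
        using b by (simp add: powr_minus_divide)
      also have "\<dots> = of_real b powr (- s)"
        using b by (simp add: powr_def Ln_of_real ln_inverse ln_div powr_minus_divide)
      finally show ?thesis by simp
    qed
    finally show "integral\<^sup>L lborel (f n) = (1 / of_nat (Suc n) powr s) * (of_real (1 / b) powr s * mellin g s)"
      by (simp add: powr_minus field_simps)
  qed
  also have "\<dots> = zeta s * (of_real (1 / b) powr s * mellin g s)"
  proof -
    have "summable (\<lambda>n. norm (1 / complex_of_real (real (Suc n)) powr s))"
      using summable_powr by (simp add: norm_divide norm_powr_real_powr powr_minus_divide del: of_nat_Suc)
    then have "summable (\<lambda>n. 1 / of_nat (Suc n) powr s :: complex)"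
      using summable_norm_cancel by (simp only: of_real_of_nat_eq)
    from suminf_mult2[OF this] show ?thesis by (simp add: zeta_def)
  qed
  finally show "mellin (\<lambda>x. \<Sum>n. g (b * x * real (Suc n))) s = of_real (1 / b) powr s * zeta s * mellin g s"
    by (simp add: mult_ac)
qed

text \<open>
  The substitution $x \mapsto 1/x$ folds the part over $(0,1]$ onto $[1,\infty)$; this is how the
  behaviour at $0$ is traded for the behaviour at infinity in the continuation below.
\<close>

lemma integral_pos_eq_integral_ge_one_inversion:
  fixes h :: "real \<Rightarrow> complex"
  assumes h: "set_integrable lborel {0<..} h"
    and k: "set_integrable lborel {1..} (\<lambda>x. (1 / x\<^sup>2) *\<^sub>R h (1 / x))"
  shows "(CLBINT x:{0<..}. h x) = (CLBINT x:{1..}. h x) + (CLBINT x:{1..}. (1 / x\<^sup>2) *\<^sub>R h (1 / x))"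
proof -
  have h1: "set_integrable lborel {0<..1} h" and h2: "set_integrable lborel {1..} h"
    by (rule set_integrable_subset[OF h]; auto)+
  have "AE x in lborel. x \<noteq> (1::real)" by (rule AE_lborel_singleton)
  then have ae: "AE x in lborel. \<not> (x \<in> {0<..1} \<and> x \<in> {1::real..})" by eventually_elim auto
  have "{0<..} = {0<..1} \<union> {1::real..}" by auto
  then have "(CLBINT x:{0<..}. h x) = (CLBINT x:{0<..1}. h x) + (CLBINT x:{1..}. h x)"
    using set_integral_Un_AE[OF ae _ _ h1 h2] by simp
  moreover have "(CLBINT x:{0<..1}. h x) = (CLBINT x:{1..}. (1 / x\<^sup>2) *\<^sub>R h (1 / x))"
  proof -
    have img: "(\<lambda>x. 1 / x) ` {1..} = {0<..1::real}"
    proof (intro equalityI subsetI)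
      fix y :: real assume "y \<in> {0<..1}"
      then show "y \<in> (\<lambda>x. 1 / x) ` {1..}"
        by (intro image_eqI[of _ _ "1 / y"]) auto
    qed auto
    have "(\<lambda>x. \<bar>- (1 / x\<^sup>2)\<bar> *\<^sub>R h (1 / x)) absolutely_integrable_on {1..} \<and>
          integral {1..} (\<lambda>x. \<bar>- (1 / x\<^sup>2)\<bar> *\<^sub>R h (1 / x)) = integral {0<..1} h \<longleftrightarrow>
          h absolutely_integrable_on (\<lambda>x. 1 / x) ` {1..} \<and> integral ((\<lambda>x. 1 / x) ` {1..}) h = integral {0<..1} h"
      by (rule has_absolute_integral_change_of_variables_real)
         (auto intro!: derivative_eq_intros inj_onI simp: power2_eq_square)
    moreover have "h absolutely_integrable_on {0<..1}"
      using h1 unfolding set_integrable_def by (rule integrable_completion[THEN iffD2, rotated]) (use h1 in \<open>auto simp: set_integrable_def\<close>)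
    ultimately have "integral {1..} (\<lambda>x. (1 / x\<^sup>2) *\<^sub>R h (1 / x)) = integral {0<..1} h"
      unfolding img by simp
    then show ?thesis
      using set_borel_integral_eq_integral(2)[OF h1] set_borel_integral_eq_integral(2)[OF k] by simp
  qed
  ultimately show ?thesis by simp
qed

lemma integral_powr_ge_one:
  fixes s :: complex
  assumes s: "Re s > 1"
  shows "set_integrable lborel {1..} (\<lambda>x. of_real x powr (- s))"
    and "(CLBINT x:{1..}. of_real x powr (- s)) = 1 / (s - 1)"
proof -
  have "(\<lambda>x::real. x powr (- Re s)) absolutely_integrable_on {1..}"
    using has_integral_powr_to_inf[of "- Re s" 1] s
    by (intro nonnegative_absolutely_integrable_1) auto
  then have r: "set_integrable lborel {1..} (\<lambda>x::real. x powr (- Re s))"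
    unfolding set_integrable_def by (subst (asm) integrable_completion) auto
  show int: "set_integrable lborel {1..} (\<lambda>x. complex_of_real x powr (- s))"
  proof (rule set_integrable_bound[OF r])
    show "set_borel_measurable lborel {1..} (\<lambda>x. complex_of_real x powr (- s))"
      unfolding set_borel_measurable_def by measurable
  qed (auto simp: norm_powr_real_powr)
  have fin: "(CLBINT x:{1..b}. of_real x powr (- s)) = of_real b powr (1 - s) / (1 - s) - 1 / (1 - s)"
    if "b \<ge> 1" for b
  proof -
    have "(CLBINT x:{1..b}. of_real x powr (- s)) = of_real b powr (1 - s) / (1 - s) - of_real 1 powr (1 - s) / (1 - s)"
      unfolding set_lebesgue_integral_def
    proof (rule integral_FTC_atLeastAtMost)
      fix x assume x: "1 \<le> x" "x \<le> b"
      have "((\<lambda>z. z powr (1 - s) / (1 - s)) has_field_derivative (of_real x powr (- s))) (at (of_real x))"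
        using x s by (auto intro!: derivative_eq_intros simp: complex_nonpos_Reals_iff)
      then show "((\<lambda>x. of_real x powr (1 - s) / (1 - s)) has_vector_derivative of_real x powr (- s)) (at x within {1..b})"
        by (rule has_vector_derivative_real_field)
    next
      show "continuous_on {1..b} (\<lambda>x. complex_of_real x powr (- s))"
        by (intro continuous_intros) auto
    qed fact
    then show ?thesis by simp
  qed
  have "((\<lambda>b. CLBINT x:{1..b}. of_real x powr (- s)) \<longlongrightarrow> (CLBINT x:{1..}. of_real x powr (- s))) at_top"
    by (rule tendsto_set_lebesgue_integral_at_top[OF _ int]) auto
  moreover have "((\<lambda>b. CLBINT x:{1..b}. of_real x powr (- s)) \<longlongrightarrow> 0 / (1 - s) - 1 / (1 - s)) at_top"
  proof (rule Lim_transform_eventually)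
    have "((\<lambda>b::real. complex_of_real b powr (1 - s)) \<longlongrightarrow> 0) at_top"
    proof (rule Lim_null_comparison)
      show "\<forall>\<^sub>F b::real in at_top. norm (complex_of_real b powr (1 - s)) \<le> b powr (1 - Re s)"
        using eventually_gt_at_top[of 0] by eventually_elim (simp add: norm_powr_real_powr)
      show "((\<lambda>b::real. b powr (1 - Re s)) \<longlongrightarrow> 0) at_top"
        using s by (intro tendsto_neg_powr filterlim_ident) auto
    qed
    then show "((\<lambda>b. of_real b powr (1 - s) / (1 - s) - 1 / (1 - s)) \<longlongrightarrow> 0 / (1 - s) - 1 / (1 - s)) at_top"
      using s by (intro tendsto_intros) auto
    show "\<forall>\<^sub>F b in at_top. of_real b powr (1 - s) / (1 - s) - 1 / (1 - s) = (CLBINT x:{1..b}. of_real x powr (- s))"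
      using eventually_ge_at_top[of 1] by eventually_elim (simp add: fin)
  qed
  ultimately have "(CLBINT x:{1..}. of_real x powr (- s)) = 0 / (1 - s) - 1 / (1 - s)"
    using tendsto_unique trivial_limit_at_top_linorder by blast
  also have "\<dots> = 1 / (s - 1)" by (simp add: minus_divide_right)
  finally show "(CLBINT x:{1..}. of_real x powr (- s)) = 1 / (s - 1)" .
qed

text \<open>
  On $[x/2, x]$ the function is at least $f(x)$, so this interval alone contributes at least
  $(x/2)^{k+1} f(x)$ to the $k$-th absolute moment.
\<close>

lemma antimono_moment_bound:
  fixes f :: "real \<Rightarrow> real"
  assumes nonneg: "\<And>x. 0 \<le> f x" and anti: "antimono_on {0..} f"
    and moment: "integrable lborel (\<lambda>x. x ^ k * f x)"
  shows "\<exists>C\<ge>0. \<forall>x>0. f x * x ^ Suc k \<le> C"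
proof -
  define M where "M = (\<integral>x. \<bar>x ^ k * f x\<bar> \<partial>lborel)"
  have "f x * x ^ Suc k \<le> 2 ^ Suc k * M" if x: "x > 0" for x
  proof -
    have "(\<integral>t. indicator {x/2..x} t * ((x/2) ^ k * f x) \<partial>lborel) \<le> M"
      unfolding M_def
    proof (rule integral_mono)
      show "integrable lborel (\<lambda>t. indicator {x/2..x} t * ((x/2) ^ k * f x))"
        by (intro integrable_mult_left integrable_real_indicator) (auto simp: x)
      show "integrable lborel (\<lambda>x. \<bar>x ^ k * f x\<bar>)" using moment by (rule integrable_abs)
      fix t
      show "indicator {x/2..x} t * ((x/2) ^ k * f x) \<le> \<bar>t ^ k * f t\<bar>"
      proof (cases "t \<in> {x/2..x}")
        case True
        then have "f x \<le> f t" using x by (intro monotone_onD[OF anti]) auto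
        moreover have "(x/2) ^ k \<le> t ^ k" using True x by (intro power_mono) auto
        ultimately have "(x/2) ^ k * f x \<le> t ^ k * f t"
          using True x nonneg by (intro mult_mono) auto
        then show ?thesis using True by simp
      qed simp
    qed
    then have "x / 2 * ((x/2) ^ k * f x) \<le> M" using x by simp
    then show ?thesis using x by (simp add: field_simps power_divide)
  qed
  moreover have "0 \<le> 2 ^ Suc k * M" unfolding M_def by simp
  ultimately show ?thesis by blast
qed

section \<open>Densities with Poisson's summation property\<close>

context
  fixes f :: "real \<Rightarrow> real"
  assumes psp: "poisson_summation_property f"
begin

lemma poisson_density_measurable [measurable]: "f \<in> borel_measurable borel"
  and poisson_density_nonneg: "0 \<le> f x"
  and poisson_density_prob: "prob_space (density lborel f)"
  and poisson_density_even: "f (- x) = f x"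
  and charfun_eq: "charfun f t = of_real (sqrt (2 * pi) * f t)"
  using psp by (auto simp: poisson_summation_property_def prob_density_def)

lemma poisson_density_antimono: "antimono_on {0..} f"
proof -
  have "antimono_on {0..} (\<lambda>t. Re (charfun f t))"
    using psp unfolding poisson_summation_property_def by blast
  then show ?thesis by (simp add: charfun_eq monotone_on_def)
qed

lemma poisson_density_zero: "sqrt (2 * pi) * f 0 = 1"
proof -
  interpret prob_space "density lborel f" by (rule poisson_density_prob)
  interpret real_distribution "density lborel f" by standard auto
  have "charfun f 0 = 1" unfolding charfun_def by (rule char_zero)
  then show ?thesis unfolding charfun_eq by (simp only: of_real_eq_1_iff)
qed

lemma poisson_density_continuous: "continuous_on UNIV f"
proof -
  interpret prob_space "density lborel f" by (rule poisson_density_prob)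
  interpret real_distribution "density lborel f" by standard auto
  have "continuous_on UNIV (\<lambda>t. Re (charfun f t) / sqrt (2 * pi))"
    unfolding charfun_def
    by (intro continuous_intros continuous_at_imp_continuous_on ballI isCont_char) auto
  then show ?thesis by (simp add: charfun_eq)
qed

lemma poisson_density_integrable: "integrable lborel f"
proof -
  interpret prob_space "density lborel f" by (rule poisson_density_prob)
  have "integrable (density lborel f) (\<lambda>_. 1::real)" by simp
  then show ?thesis by (subst (asm) integrable_density) (auto simp: poisson_density_nonneg)
qed

text \<open>
  Self-reciprocity in real form: the real part of the characteristic function is the cosine
  transform, and evenness reduces it to the half line.
\<close>

lemma cosine_transform_half_line:
  "2 * (LBINT x:{0..}. f x * cos (t * x)) = sqrt (2 * pi) * f t"
proof -
  have int: "integrable lborel (\<lambda>x. f x * cos (t * x))"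
    by (rule Bochner_Integration.integrable_bound[OF poisson_density_integrable])
       (auto simp: abs_mult mult_left_le)
  have cint: "integrable lborel (\<lambda>x. iexp (t * x) * of_real (f x))"
    by (rule Bochner_Integration.integrable_bound[OF poisson_density_integrable]) (auto simp: norm_mult)
  have "charfun f t = (CLBINT x. iexp (t * x) * of_real (f x))"
    using psp by (intro charfun_eq_integral) (simp add: poisson_summation_property_def)
  then have "Re (charfun f t) = (LBINT x. Re (iexp (t * x) * of_real (f x)))"
    using integral_Re[OF cint] by simp
  then have "sqrt (2 * pi) * f t = (LBINT x. f x * cos (t * x))"
    by (simp add: charfun_eq Re_exp mult.commute)
  also have "has_bochner_integral lborel (\<lambda>x. f x * cos (t * x)) (2 *\<^sub>R (LBINT x:{0..}. f x * cos (t * x)))"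
    unfolding set_lebesgue_integral_def
    by (intro has_bochner_integral_even_function has_bochner_integral_integrable integrable_mult_indicator int)
       (auto simp: poisson_density_even)
  then have "(LBINT x. f x * cos (t * x)) = 2 * (LBINT x:{0..}. f x * cos (t * x))"
    by (simp add: has_bochner_integral_integral_eq)
  finally show ?thesis by simp
qed

lemma charfun_measurable [measurable]: "charfun f \<in> borel_measurable borel"
proof -
  have "charfun f = (\<lambda>t. of_real (sqrt (2 * pi) * f t))" by (intro ext charfun_eq)
  then show ?thesis by simp
qed

lemma psi_measurable: "psi f \<in> borel_measurable borel"
  unfolding psi_def[abs_def] by measurable

context
  assumes moments: "\<And>k::nat. integrable lborel (\<lambda>x. x ^ k * f x)"
begin

lemma summable_samples:
  assumes b: "b > 0"
  shows "summable (\<lambda>n. f (b * real n))"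
proof -
  obtain C where C: "C \<ge> 0" "\<And>x. x > 0 \<Longrightarrow> f x * x ^ Suc 1 \<le> C"
    using antimono_moment_bound[OF poisson_density_nonneg poisson_density_antimono moments[of 1]] by blast
  show ?thesis
  proof (rule summable_comparison_test'[of "\<lambda>n. C / b\<^sup>2 * (1 / real n ^ 2)" 1])
    show "summable (\<lambda>n. C / b\<^sup>2 * (1 / real n ^ 2))"
      using inverse_power_summable[of 2, where 'a = real] by (intro summable_mult) (simp add: field_simps)
    show "norm (f (b * real n)) \<le> C / b\<^sup>2 * (1 / real n ^ 2)" if "n \<ge> 1" for n
      using C(2)[of "b * real n"] b that poisson_density_nonneg
      by (simp add: field_simps power2_eq_square)
  qed
qed

lemma summable_charfun:
  assumes x: "x > 0"
  shows "summable (\<lambda>n. norm (charfun f (sqrt (2 * pi) * x * real (Suc n))))"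
proof -
  have "summable (\<lambda>n. f ((sqrt (2 * pi) * x) * real (Suc n)))"
    using summable_samples[of "sqrt (2 * pi) * x"] x
      summable_Suc_iff[of "\<lambda>n. f ((sqrt (2 * pi) * x) * real n)"] by simp
  from summable_mult[OF this, of "sqrt (2 * pi)"] show ?thesis
    by (simp add: charfun_eq norm_mult poisson_density_nonneg abs_of_nonneg del: of_nat_Suc)
qed

lemma psi_eq:
  assumes x: "x > 0"
  shows "psi f x = of_real (\<Sum>n. sqrt (2 * pi) * f (sqrt (2 * pi) * x * real (Suc n)))"
proof -
  have "summable (\<lambda>n. sqrt (2 * pi) * f (sqrt (2 * pi) * x * real (Suc n)))"
    using summable_charfun[OF x] by (simp add: charfun_eq norm_mult poisson_density_nonneg abs_of_nonneg del: of_nat_Suc)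
  then show ?thesis
    unfolding psi_def charfun_eq by (simp only: suminf_of_real)
qed

text \<open>
  Poisson summation for $h(y) = \hat f(\sqrt{2\pi}\, x y)$. By self-reciprocity the $k$-th cosine
  coefficient of $h$ is $\hat f(\sqrt{2\pi}\, k / x) / x$ (the identity $2\pi = \sqrt{2\pi}^2$
  makes the frequencies fit), so that $1 + 2\psi(x) = (1 + 2\psi(1/x))/x$.
\<close>

lemma psi_reciprocal:
  assumes x: "x > 0"
  shows "psi f (1 / x) = of_real x * psi f x + of_real x / 2 - 1 / 2"
proof -
  define w where "w = sqrt (2 * pi)"
  have w: "w > 0" "w * w = 2 * pi" by (auto simp: w_def)
  define h where "h = (\<lambda>y. w * f (w * x * y))"
  define c where "c = (\<lambda>k::nat. w * f (w * (1 / x) * real k) / x)"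
  have "h 0 + 2 * (\<Sum>n. h (real (Suc n))) = c 0 + 2 * (\<Sum>k. c (Suc k))"
  proof (rule poisson_summation_cosine)
    show "continuous_on UNIV h"
      unfolding h_def by (intro continuous_intros continuous_on_compose2[OF poisson_density_continuous]) auto
    show "0 \<le> h y" for y using w by (simp add: h_def poisson_density_nonneg)
    show "antimono_on {0..} h"
      unfolding h_def using w x
      by (intro monotone_onI mult_left_mono monotone_onD[OF poisson_density_antimono]) auto
    have "integrable lborel (\<lambda>y. f (0 + (w * x) * y))"
      using w x by (intro lborel_integrable_real_affine poisson_density_integrable) auto
    then have "integrable lborel h" unfolding h_def by simp
    then show "set_integrable lborel {0..} h"
      unfolding set_integrable_def by (rule integrable_mult_indicator[rotated]) auto
    show "summable (\<lambda>n. h (real n))"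
      unfolding h_def using w x by (intro summable_mult summable_samples) auto
    have "summable (\<lambda>k. w * f (w * (1 / x) * real k) / x)"
      using w x by (intro summable_divide summable_mult summable_samples) auto
    then show "summable (\<lambda>k. \<bar>c k\<bar>)"
      using w x by (simp add: c_def abs_mult poisson_density_nonneg)
    show "c k = 2 * (LBINT y:{0..}. h y * cos (2 * pi * real k * y))" for k
    proof -
      let ?t = "w * (1 / x) * real k"
      define F where "F u = indicator {0..} u *\<^sub>R (f u * cos (?t * u))" for u
      have "w * f ?t = 2 * integral\<^sup>L lborel F"
        using cosine_transform_half_line[of ?t, folded w_def]
        unfolding set_lebesgue_integral_def F_def[symmetric] by simp
      also have "integral\<^sup>L lborel F = (w * x) * (LBINT y. F (0 + (w * x) * y))"
        using lborel_integral_real_affine[of "w * x" F 0] w x by simp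
      finally have "c k = 2 * (w * (LBINT y. F (0 + (w * x) * y)))"
        using x w(1) by (auto simp: c_def field_simps)
      moreover have "w * F (0 + (w * x) * y) = indicator {0..} y *\<^sub>R (h y * cos (2 * pi * real k * y))" for y
      proof -
        have "?t * (w * x * y) = w * w * real k * y" using x by simp
        moreover have "indicator {0..} (w * x * y) = (indicator {0..} y :: real)"
          using zero_le_mult_iff[of "w * x" y] mult_pos_pos[OF w(1) x] by (auto simp: indicator_def)
        ultimately show ?thesis using w(2) by (simp add: F_def h_def)
      qed
      then have "w * (LBINT y. F (0 + (w * x) * y)) = (LBINT y:{0..}. h y * cos (2 * pi * real k * y))"
        unfolding set_lebesgue_integral_def by (subst integral_mult_right_zero[symmetric]) simp
      ultimately show ?thesis by simp
    qed
  qed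
  moreover have "h 0 = 1" "c 0 = 1 / x" using poisson_density_zero by (auto simp: h_def c_def w_def)
  moreover have "psi f x = of_real (\<Sum>n. h (real (Suc n)))"
    unfolding psi_eq[OF x] h_def w_def ..
  moreover have "psi f (1 / x) = of_real (x * (\<Sum>k. c (Suc k)))"
  proof -
    have "summable (\<lambda>k. w * f (w * (1 / x) * real k) / x)"
      using w x by (intro summable_divide summable_mult summable_samples) auto
    then have "summable (\<lambda>k. c (Suc k))"
      using summable_Suc_iff[of c] by (simp add: c_def)
    then have "x * (\<Sum>k. c (Suc k)) = (\<Sum>k. x * c (Suc k))" by (rule suminf_mult[symmetric])
    also have "\<dots> = (\<Sum>n. w * f (w * (1 / x) * real (Suc n)))" using x by (simp add: c_def)
    finally show ?thesis using psi_eq[of "1 / x"] x by (simp add: w_def)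
  qed
  ultimately have "psi f (1 / x) = of_real (x * ((1 + 2 * (\<Sum>n. h (real (Suc n))) - 1 / x) / 2))"
    by simp
  also have "x * ((1 + 2 * (\<Sum>n. h (real (Suc n))) - 1 / x) / 2) = x * (\<Sum>n. h (real (Suc n))) + x / 2 - 1 / 2"
    using x by (simp add: field_simps)
  finally show ?thesis using \<open>psi f x = _\<close> by simp
qed

text \<open>
  Near infinity the moments control the integrand; on $(0,1]$ it is bounded by $f(0)$, as
  $|x^{s-1}| \le 1$ there.
\<close>

lemma mellin_convergent_density:
  assumes s: "Re s > 1"
  shows "mellin_convergent (\<lambda>x. of_real (f x)) s"
proof -
  let ?h = "\<lambda>x. complex_of_real x powr (s - 1) * of_real (f x)"
  have "set_integrable lborel {1..} ?h"
  proof (rule set_integrable_powr_mult_of_moments)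
    show "set_integrable lborel {1..} (\<lambda>x. x ^ k *\<^sub>R complex_of_real (f x))" for k
      unfolding set_integrable_def
      using integrable_of_real[OF moments[of k], where 'a = complex]
      by (intro integrable_mult_indicator) (auto simp: scaleR_conv_of_real)
  qed measurable
  moreover have "set_integrable lborel {0<..1} ?h"
  proof (rule set_integrable_bound)
    show "set_integrable lborel {0<..1::real} (\<lambda>_. f 0)"
      unfolding set_integrable_def by simp
    show "set_borel_measurable lborel {0<..1} ?h"
      unfolding set_borel_measurable_def by measurable
    show "AE x in lborel. x \<in> {0<..1} \<longrightarrow> norm (?h x) \<le> norm (f 0)"
    proof (intro always_eventually allI impI)
      fix x :: real assume x: "x \<in> {0<..1}"
      have "x powr (Re s - 1) \<le> 1" using x s powr_mono2[of "Re s - 1" x 1] by auto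
      moreover have "f x \<le> f 0" using x by (intro monotone_onD[OF poisson_density_antimono]) auto
      ultimately have "x powr (Re s - 1) * f x \<le> 1 * f 0" by (intro mult_mono poisson_density_nonneg) auto
      then show "norm (?h x) \<le> norm (f 0)"
        using x by (simp add: norm_mult norm_powr_real_powr poisson_density_nonneg)
    qed
  qed
  ultimately have "set_integrable lborel ({0<..1} \<union> {1..}) ?h"
    by (intro set_integrable_Un) auto
  moreover have "{0<..1} \<union> {1..} = {0::real<..}" by auto
  ultimately show ?thesis by (simp add: mellin_convergent_def)
qed

lemma mellin_convergent_charfun:
  assumes "Re s > 1"
  shows "mellin_convergent (charfun f) s"
  using set_integrable_mult_right[of "of_real (sqrt (2 * pi))" lborel "{0<..}" "\<lambda>x. complex_of_real x powr (s - 1) * of_real (f x)"]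
    mellin_convergent_density[OF assms] unfolding mellin_convergent_def charfun_eq
  by (simp add: mult_ac)

lemma mellin_charfun: "mellin (charfun f) s = of_real (sqrt (2 * pi)) * mellin (\<lambda>x. of_real (f x)) s"
proof -
  have "mellin (charfun f) s = (CLBINT x:{0<..}. of_real (sqrt (2 * pi)) * (of_real x powr (s - 1) * of_real (f x)))"
    unfolding mellin_def charfun_eq by (simp add: mult_ac)
  then show ?thesis unfolding mellin_def by simp
qed

lemma mellin_convergent_psi:
  assumes "Re s > 1"
  shows "mellin_convergent (psi f) s"
  unfolding psi_def[abs_def]
  by (rule mellin_dirichlet_sum(1)[OF _ assms mellin_convergent_charfun[OF assms] summable_charfun]) auto

lemma mellin_psi:
  assumes "Re s > 1"
  shows "mellin (psi f) s = of_real (1 / sqrt (2 * pi)) powr s * zeta s * mellin (charfun f) s"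
  unfolding psi_def[abs_def]
  by (rule mellin_dirichlet_sum(2)[OF _ assms mellin_convergent_charfun[OF assms] summable_charfun]) auto

text \<open>
  That \<open>psi\<close> decays at infinity, in an integrated sense, is read off from the convergence of its Mellin transform
  at the real point $k + 2$.
\<close>

lemma psi_moments: "set_integrable lborel {1..} (\<lambda>x. x ^ k *\<^sub>R psi f x)"
proof (rule set_integrable_bound)
  have "mellin_convergent (psi f) (of_nat k + 2)" by (rule mellin_convergent_psi) simp
  then show "set_integrable lborel {1..} (\<lambda>x. of_real x powr (of_nat k + 2 - 1) * psi f x)"
    unfolding mellin_convergent_def by (rule set_integrable_subset) auto
  note [measurable] = psi_measurable
  show "set_borel_measurable lborel {1..} (\<lambda>x. x ^ k *\<^sub>R psi f x)"
    unfolding set_borel_measurable_def by measurable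
  show "AE x in lborel. x \<in> {1..} \<longrightarrow> norm (x ^ k *\<^sub>R psi f x) \<le> norm (of_real x powr (of_nat k + 2 - 1) * psi f x)"
  proof (intro always_eventually allI impI)
    fix x :: real assume x: "x \<in> {1..}"
    have "x ^ k = x powr real k" using x by (simp add: powr_realpow)
    also have "\<dots> \<le> x powr (real k + 1)" using x by (intro powr_mono) auto
    finally show "norm (x ^ k *\<^sub>R psi f x) \<le> norm (of_real x powr (of_nat k + 2 - 1) * psi f x)"
      using x mult_right_mono[of "x ^ k" "x powr (real k + 1)" "norm (psi f x)"]
      by (simp add: norm_mult norm_powr_real_powr add.commute)
  qed
qed

definition tail_mellin :: "complex \<Rightarrow> complex" where
  "tail_mellin s = (CLBINT x:{1..}. of_real x powr s * psi f x)"

lemma tail_integrable: "set_integrable lborel {1..} (\<lambda>x. of_real x powr s * psi f x)"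
  by (rule set_integrable_powr_mult_of_moments[OF psi_measurable psi_moments])

lemma tail_entire: "tail_mellin holomorphic_on UNIV"
  unfolding tail_mellin_def[abs_def] by (rule entire_integral_powr[OF psi_measurable psi_moments])

text \<open>
  Fold the integral over $(0,1]$ onto $[1,\infty)$ and replace $\psi(1/x)$ by
  \<open>psi_reciprocal\<close>. The summand $x\,\psi(x)$ gives \<open>tail_mellin (- s)\<close>, and the elementary
  summands give $1/(2(s-1)) - 1/(2s)$. The right-hand side is meaningful for every $s \ne 0, 1$ and
  symmetric under $s \mapsto 1 - s$.
\<close>

lemma mellin_psi_continuation:
  assumes s: "Re s > 1"
  shows "mellin (psi f) s = tail_mellin (s - 1) + tail_mellin (- s) + 1 / (2 * s * (s - 1))"
proof -
  define h where "h = (\<lambda>x. complex_of_real x powr (s - 1) * psi f x)"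
  define r where "r = (\<lambda>x. complex_of_real x powr (- s) * psi f x + complex_of_real x powr (- s) / 2
       - complex_of_real x powr (- (s + 1)) / 2)"
  have s': "Re (s + 1) > 1" using s by simp
  have r: "(1 / x\<^sup>2) *\<^sub>R h (1 / x) = r x" if "x \<in> {1..}" for x
  proof -
    have x: "x > 0" using that by simp
    define X where "X = complex_of_real x"
    have X: "X \<noteq> 0" using x by (simp add: X_def)
    have inv: "complex_of_real (1 / x) powr (s - 1) = X powr (1 - s)"
      using x Ln_of_real[of "1 / x"] by (simp add: X_def powr_def Ln_of_real ln_div algebra_simps)
    have p: "X powr (1 - s) = X * X powr (- s)" "X powr (- (s + 1)) = X powr (- s) / X"
      using X by (simp_all add: powr_diff powr_minus powr_add field_simps)
    show ?thesis
      unfolding h_def r_def psi_reciprocal[OF x] inv scaleR_conv_of_real X_def[symmetric] p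
      using X by (simp add: X_def field_simps power2_eq_square)
  qed
  have i1: "set_integrable lborel {1..} (\<lambda>x. complex_of_real x powr (- s) / 2)"
    and i2: "set_integrable lborel {1..} (\<lambda>x. complex_of_real x powr (- (s + 1)) / 2)"
    using integral_powr_ge_one(1)[OF s] integral_powr_ge_one(1)[OF s'] by simp_all
  have r_int: "set_integrable lborel {1..} r"
    unfolding r_def by (intro set_integral_add set_integral_diff tail_integrable i1 i2)
  have h_int: "set_integrable lborel {0<..} h"
    using mellin_convergent_psi[OF s] by (simp add: mellin_convergent_def h_def)
  have "mellin (psi f) s = (CLBINT x:{0<..}. h x)" by (simp add: mellin_def h_def)
  also have "\<dots> = (CLBINT x:{1..}. h x) + (CLBINT x:{1..}. (1 / x\<^sup>2) *\<^sub>R h (1 / x))"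
    using r_int by (intro integral_pos_eq_integral_ge_one_inversion h_int)
      (subst set_integrable_cong[OF refl refl r]; simp)
  also have "(CLBINT x:{1..}. (1 / x\<^sup>2) *\<^sub>R h (1 / x)) = (CLBINT x:{1..}. r x)"
    by (intro set_lebesgue_integral_cong) (auto simp: r)
  also have "\<dots> = tail_mellin (- s) + 1 / (s - 1) / 2 - 1 / (s + 1 - 1) / 2"
  proof -
    have "(CLBINT x:{1..}. r x) = (CLBINT x:{1..}. of_real x powr (- s) * psi f x)
        + (CLBINT x:{1..}. of_real x powr (- s) / 2) - (CLBINT x:{1..}. of_real x powr (- (s + 1)) / 2)"
      unfolding r_def
      by (simp only: set_integral_add set_integral_diff tail_integrable i1 i2)
    also have "(CLBINT x:{1..}. of_real x powr (- s) / 2) = 1 / (s - 1) / 2"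
      using integral_powr_ge_one(2)[OF s] by simp
    also have "(CLBINT x:{1..}. of_real x powr (- (s + 1)) / 2) = 1 / (s + 1 - 1) / 2"
      using integral_powr_ge_one(2)[OF s'] by simp
    finally show ?thesis by (simp add: tail_mellin_def)
  qed
  also have "(CLBINT x:{1..}. h x) = tail_mellin (s - 1)" by (simp add: h_def tail_mellin_def)
  finally have "mellin (psi f) s = tail_mellin (s - 1) + (tail_mellin (- s) + 1 / (s - 1) / 2 - 1 / (s + 1 - 1) / 2)" .
  moreover have "1 / (s - 1) / 2 - 1 / (s + 1 - 1) / 2 = 1 / (2 * s * (s - 1))"
  proof -
    have "s \<noteq> 0" "s - 1 \<noteq> 0" using s by auto
    then show ?thesis by (simp add: divide_simps)
  qed
  ultimately show ?thesis by (simp add: algebra_simps)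
qed

text \<open>
  Multiplying the continuation formula by $s(s-1)$ cancels both poles and leaves the constant
  $1/2$, so the function below is entire; the substitution $s \mapsto 1 - s$ swaps the two
  values of \<open>tail_mellin\<close>.
\<close>

lemma xi_exists:
  "\<exists>\<xi>::complex \<Rightarrow> complex. \<xi> holomorphic_on UNIV \<and>
     (\<forall>s. Re s > 1 \<longrightarrow> \<xi> s = s * (s - 1) * mellin (psi f) s) \<and> (\<forall>s. \<xi> s = \<xi> (1 - s))"
proof -
  define \<xi> where "\<xi> = (\<lambda>s. s * (s - 1) * (tail_mellin (s - 1) + tail_mellin (- s)) + 1 / 2)"
  have T: "(\<lambda>s. tail_mellin (g s)) holomorphic_on UNIV" if "g holomorphic_on UNIV" for g
    using holomorphic_on_compose_gen[OF that tail_entire] by (simp add: o_def)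
  have "\<xi> holomorphic_on UNIV"
    unfolding \<xi>_def by (intro holomorphic_intros T)
  moreover have "\<xi> s = s * (s - 1) * mellin (psi f) s" if s: "Re s > 1" for s
  proof -
    have "s \<noteq> 0" "s - 1 \<noteq> 0" using s by auto
    then show ?thesis unfolding \<xi>_def mellin_psi_continuation[OF s] by (simp add: field_simps)
  qed
  moreover have "\<xi> s = \<xi> (1 - s)" for s
    by (simp add: \<xi>_def algebra_simps)
  ultimately show ?thesis by blast
qed

end

end

theorem theorem1:
  fixes f :: "real \<Rightarrow> real"
  assumes psp: "poisson_summation_property f"
    and moments: "\<And>k::nat. integrable lborel (\<lambda>x. x ^ k * f x)"
  shows
    "(\<forall>x>0. summable (\<lambda>n. charfun f (sqrt (2 * pi) * x * real (Suc n)))) \<and>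
     (\<forall>s::complex. Re s > 1 \<longrightarrow>
        mellin_convergent (psi f) s \<and>
        mellin_convergent (charfun f) s \<and>
        mellin_convergent (\<lambda>x. of_real (f x)) s \<and>
        mellin (psi f) s =
          of_real (1 / sqrt (2 * pi)) powr s * zeta s * mellin (charfun f) s \<and>
        of_real (1 / sqrt (2 * pi)) powr s * zeta s * mellin (charfun f) s =
          of_real (1 / sqrt (2 * pi)) powr (s - 1) * zeta s * mellin (\<lambda>x. of_real (f x)) s) \<and>
     (\<exists>\<xi>::complex \<Rightarrow> complex.
        \<xi> holomorphic_on UNIV \<and>
        (\<forall>s. Re s > 1 \<longrightarrow> \<xi> s = s * (s - 1) * mellin (psi f) s) \<and>
        (\<forall>s. \<xi> s = \<xi> (1 - s)))"
proof (intro conjI allI impI)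
  show "summable (\<lambda>n. charfun f (sqrt (2 * pi) * x * real (Suc n)))" if "x > 0" for x
    by (rule summable_norm_cancel[OF summable_charfun[OF psp moments that]])
next
  fix s :: complex
  assume s: "Re s > 1"
  show "mellin_convergent (psi f) s" by (rule mellin_convergent_psi[OF psp moments s])
  show "mellin_convergent (charfun f) s" by (rule mellin_convergent_charfun[OF psp moments s])
  show "mellin_convergent (\<lambda>x. of_real (f x)) s" by (rule mellin_convergent_density[OF psp moments s])
  show "mellin (psi f) s = of_real (1 / sqrt (2 * pi)) powr s * zeta s * mellin (charfun f) s"
    by (rule mellin_psi[OF psp moments s])
  have "complex_of_real (1 / sqrt (2 * pi)) powr (s - 1) = of_real (1 / sqrt (2 * pi)) powr s * of_real (sqrt (2 * pi))"
    by (simp add: powr_diff field_simps)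
  then show "of_real (1 / sqrt (2 * pi)) powr s * zeta s * mellin (charfun f) s =
          of_real (1 / sqrt (2 * pi)) powr (s - 1) * zeta s * mellin (\<lambda>x. of_real (f x)) s"
    by (simp add: mellin_charfun[OF psp moments] mult_ac)
next
  show "\<exists>\<xi>::complex \<Rightarrow> complex. \<xi> holomorphic_on UNIV \<and>
        (\<forall>s. Re s > 1 \<longrightarrow> \<xi> s = s * (s - 1) * mellin (psi f) s) \<and> (\<forall>s. \<xi> s = \<xi> (1 - s))"
    by (rule xi_exists[OF psp moments])
qed

end
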